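(* Let $\mu=\{\mu_k\}_{k=0}^\infty$ be a sequence of complex numbers, let $\gamma_k=\sum_{j=0}^{\lfloor k/2\rfloor}\binom{k}{j}\mu_{k-2j}$, let $n$ be a positive integer, and let $P_{\mu,n}(z)=\sum_{k=0}^n\gamma_k\binom{n}{k}z^{n-k}$. Let $P(z)=1+a_1z+\cdots+a_nz^n=\prod_{j=1}^n(1+\rho_jz)$ be a complex polynomial of degree $n$. Suppose that $K$ is a circular region containing no zeros of $P_{\mu,n}(z)$, and that $K$ is convex if $\mu_0=\gamma_0=0$. If $\zeta$ is a non-zero complex number for which $$\left\{\rho_i\zeta+\frac{1}{\rho_i\zeta}:1\le i\le n\right\}\subset K,$$ then $T_\mu(P)(\zeta)\neq0$.
   Context: A circular region is a proper subset of $\mathbb{C}$ that is bounded by either a circle or a straight line, and is either open or closed. The operator $T_\mu:\mathbb{C}[z]\to\mathbb{C}[z]$ is defined by $T_\mu(\sum_{k=0}^na_kz^k)=\sum_{i\le j}\mu_{j-i}a_ia_jz^{i+j}$. *)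

theory Defs
  imports "HOL-Analysis.Analysis" "HOL-Computational_Algebra.Polynomial"
begin

text \<open>The regions are listed explicitly: requiring only that \<open>K\<close> be open or closed with a circle or
  a line as its frontier would also admit the curve itself and its complement.
  The other side of a line is obtained by replacing \<open>(a, b)\<close> by \<open>(-a, -b)\<close>.\<close>

definition circular_region :: "complex set \<Rightarrow> bool" where
  "circular_region K \<longleftrightarrow>
     (\<exists>c r. r > 0 \<and> (K = ball c r \<or> K = cball c r \<or> K = - ball c r \<or> K = - cball c r)) \<or>
     (\<exists>a b. a \<noteq> 0 \<and> (K = {z. a \<bullet> z < b} \<or> K = {z. a \<bullet> z \<le> b}))"

definition T_op :: "(nat \<Rightarrow> complex) \<Rightarrow> complex poly \<Rightarrow> complex poly" where
  "T_op \<mu> p = (\<Sum>j\<le>degree p. \<Sum>i\<le>j. monom (\<mu> (j - i) * coeff p i * coeff p j) (i + j))"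

definition gamma_seq :: "(nat \<Rightarrow> complex) \<Rightarrow> nat \<Rightarrow> complex" where
  "gamma_seq \<mu> k = (\<Sum>j\<le>k div 2. of_nat (k choose j) * \<mu> (k - 2 * j))"

definition P_mu :: "(nat \<Rightarrow> complex) \<Rightarrow> nat \<Rightarrow> complex poly" where
  "P_mu \<mu> n = (\<Sum>k\<le>n. monom (gamma_seq \<mu> k * of_nat (n choose k)) (n - k))"

end

(*
  With x_i = rho_i zeta and y_i = x_i + 1/x_i, the value of T_mu(P) at zeta is a Toeplitz quadratic form
  in the elementary symmetric polynomials of the x_i, and it equals (prod x_i) * Phi(y_1, ..., y_n),
  where Phi is the symmetric multiaffine form with Phi(z, ..., z) = P_{mu,n}(z).  The theorem is thus
  an instance of the Grace-Walsh-Szego coincidence theorem.  The latter follows by polarising one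
  variable at a time with Laguerre's theorem.  Circular regions are treated uniformly as the sublevel
  sets of Q(z) = alpha |z|^2 + beta . z + delta: after inversion about a point of the region, Q
  becomes concave, and Laguerre's theorem becomes Jensen's inequality for the roots.
*)

theory Submission
  imports Defs "HOL-Computational_Algebra.Fundamental_Theorem_Algebra"
begin

section \<open>Roots of complex polynomials: logarithmic derivative and the sum of the roots\<close>

lemma poly_roots_indexed:
  fixes p :: "complex poly"
  assumes "p \<noteq> 0"
  obtains r where "p = smult (lead_coeff p) (\<Prod>i<degree p. [:- r i, 1:])"
proof -
  obtain A where A: "size A = degree p" "p = smult (lead_coeff p) (\<Prod>x\<in>#A. [:- x, 1:])"
    using alg_closed_imp_factorization[OF assms] by blast
  obtain xs where xs: "mset xs = A" using ex_mset by blast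
  have len: "length xs = degree p" using A(1) xs by auto
  have "(\<Prod>x\<in>#A. [:- x, 1:]) = prod_list (map (\<lambda>x. [:- x, 1:]) xs)"
    by (metis xs mset_map prod_mset_prod_list)
  also have "\<dots> = (\<Prod>i<degree p. [:- (xs ! i), 1:])"
    by (simp add: prod.list_conv_set_nth len atLeast0LessThan)
  finally show ?thesis using A(2) that[of "\<lambda>i. xs ! i"] by simp
qed

lemma poly_pderiv_prod_linear:
  fixes r :: "nat \<Rightarrow> complex"
  assumes "\<And>i. i < m \<Longrightarrow> z \<noteq> r i"
  shows "poly (pderiv (\<Prod>i<m. [:- r i, 1:])) z =
    poly (\<Prod>i<m. [:- r i, 1:]) z * (\<Sum>i<m. 1 / (z - r i))"
  using assms
proof (induction m)
  case (Suc m)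
  have "z - r m \<noteq> 0" using Suc.prems[of m] by auto
  moreover have "poly (pderiv (\<Prod>i<m. [:- r i, 1:])) z =
    poly (\<Prod>i<m. [:- r i, 1:]) z * (\<Sum>i<m. 1 / (z - r i))" using Suc by auto
  ultimately show ?case
    unfolding prod.lessThan_Suc sum.lessThan_Suc pderiv_mult poly_add poly_mult
    by (simp add: pderiv_pCons field_simps)
qed simp

lemma degree_prod_linear: "degree (\<Prod>i<m. [:- r i, 1 :: complex:]) = m"
  by (simp add: degree_prod_eq_sum_degree)

lemma coeff_prod_linear_top: "coeff (\<Prod>i<m. [:- r i, 1 :: complex:]) m = 1"
proof -
  have "lead_coeff (\<Prod>i<m. [:- r i, 1 :: complex:]) = 1" by (simp add: lead_coeff_prod)
  then show ?thesis by (simp add: degree_prod_linear)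
qed

lemma coeff_prod_linear_subtop:
  "coeff (\<Prod>i<Suc m. [:- r i, 1 :: complex:]) m = - (\<Sum>i<Suc m. r i)"
proof (induction m)
  case (Suc m)
  have "coeff (\<Prod>i<Suc (Suc m). [:- r i, 1 :: complex:]) (Suc m) =
      coeff ([:- r (Suc m), 1:] * (\<Prod>i<Suc m. [:- r i, 1 :: complex:])) (Suc m)"
    by (simp only: prod.lessThan_Suc[of _ "Suc m"] mult.commute)
  also have "\<dots> = - r (Suc m) * coeff (\<Prod>i<Suc m. [:- r i, 1 :: complex:]) (Suc m)
      + coeff (\<Prod>i<Suc m. [:- r i, 1 :: complex:]) m"
    by (simp del: prod.lessThan_Suc)
  also have "\<dots> = - (\<Sum>i<Suc (Suc m). r i)"
    by (simp only: Suc.IH coeff_prod_linear_top) simp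
  finally show ?case .
qed simp

section \<open>Circular regions as sublevel sets of a quadratic form\<close>

definition circ_form :: "real \<Rightarrow> complex \<Rightarrow> real \<Rightarrow> complex \<Rightarrow> real" where
  "circ_form \<alpha> \<beta> \<delta> z = \<alpha> * (norm z)\<^sup>2 + \<beta> \<bullet> z + \<delta>"

text \<open>Discs get alpha = 1, half-planes alpha = 0 and exteriors of discs alpha = -1. Since
  exteriors are never convex, convexity of \<open>K\<close> enters the later argument only through
  the sign of alpha.\<close>

lemma circular_region_circ_form:
  assumes "circular_region K"
  obtains \<alpha> \<beta> \<delta> where "K = {z. circ_form \<alpha> \<beta> \<delta> z < 0} \<or> K = {z. circ_form \<alpha> \<beta> \<delta> z \<le> 0}"
    "convex K \<Longrightarrow> \<alpha> \<ge> 0"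
proof -
  have dist2: "(dist c z)\<^sup>2 = (norm z)\<^sup>2 + (-2 *\<^sub>R c) \<bullet> z + (norm c)\<^sup>2" for c z :: complex
    by (simp add: dist_norm power2_norm_eq_inner inner_diff inner_commute algebra_simps)
  have less: "dist c z < r \<longleftrightarrow> circ_form 1 (-2 *\<^sub>R c) ((norm c)\<^sup>2 - r\<^sup>2) z < 0" if "r > 0" for c z r
  proof -
    have "dist c z < r \<longleftrightarrow> (dist c z)\<^sup>2 < r\<^sup>2"
      using that power_mono_iff[of r "dist c z" 2] by (simp add: not_le[symmetric])
    then show ?thesis by (simp add: circ_form_def dist2 del: scaleR_minus_left) argo
  qed
  have le: "dist c z \<le> r \<longleftrightarrow> circ_form 1 (-2 *\<^sub>R c) ((norm c)\<^sup>2 - r\<^sup>2) z \<le> 0" if "r > 0" for c z r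
  proof -
    have "dist c z \<le> r \<longleftrightarrow> (dist c z)\<^sup>2 \<le> r\<^sup>2"
      using that by (simp add: power_mono_iff)
    then show ?thesis by (simp add: circ_form_def dist2 del: scaleR_minus_left) argo
  qed
  have neg: "circ_form (-1) (2 *\<^sub>R c) (r\<^sup>2 - (norm c)\<^sup>2) z = - circ_form 1 (-2 *\<^sub>R c) ((norm c)\<^sup>2 - r\<^sup>2) z"
    for c z r by (simp add: circ_form_def)
  have nonconvex: "\<not> convex (- ball c r)" "\<not> convex (- cball c r)" if "r > 0" for c :: complex and r
  proof -
    \<comment> \<open>The centre is the midpoint of two points outside the closed disc, so a convex
      set containing the exterior would contain the centre too.\<close>
    have mid: "c = (1/2) *\<^sub>R (c + of_real (2*r)) + (1/2) *\<^sub>R (c - of_real (2*r))"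
      by (simp add: complex_eq_iff field_simps)
    have out: "c + of_real (2*r) \<in> - cball c r" "c - of_real (2*r) \<in> - cball c r"
      using that by (simp_all add: dist_norm)
    have *: "c \<in> S" if S: "convex S" "- cball c r \<subseteq> S" for S
      using convexD[OF S(1) subsetD[OF S(2) out(1)] subsetD[OF S(2) out(2)], of "1/2" "1/2"]
      by (subst mid) simp
    show "\<not> convex (- ball c r)" "\<not> convex (- cball c r)"
      using *[of "- ball c r"] *[of "- cball c r"] that by auto
  qed
  from assms consider (disc) c r where "r > 0" "K = ball c r \<or> K = cball c r"
    | (ext) c r where "r > 0" "K = - ball c r \<or> K = - cball c r"
    | (half) a b where "K = {z. a \<bullet> z < b} \<or> K = {z. a \<bullet> z \<le> b}"
    unfolding circular_region_def by metis
  then show ?thesis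
  proof cases
    case disc
    then show ?thesis
      using that[of 1 "-2 *\<^sub>R c" "(norm c)\<^sup>2 - r\<^sup>2"] less[OF disc(1), of c] le[OF disc(1), of c]
      by (auto simp: ball_def cball_def)
  next
    case ext
    have "K = {z. circ_form (-1) (2 *\<^sub>R c) (r\<^sup>2 - (norm c)\<^sup>2) z < 0} \<or>
        K = {z. circ_form (-1) (2 *\<^sub>R c) (r\<^sup>2 - (norm c)\<^sup>2) z \<le> 0}"
      unfolding neg using ext(2) less[OF ext(1), of c] le[OF ext(1), of c]
      by (auto simp: ball_def cball_def not_less not_le)
    moreover have "\<not> convex K" using nonconvex[OF ext(1)] ext(2) by auto
    ultimately show ?thesis using that by blast
  next
    case half
    then show ?thesis using that[of 0 a "-b"] by (auto simp: circ_form_def)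
  qed
qed

section \<open>Jensen inequalities for the form and Laguerre's theorem\<close>

lemma norm_sum_power2_le:
  fixes w :: "nat \<Rightarrow> complex"
  shows "(norm (\<Sum>i<m. w i))\<^sup>2 \<le> real m * (\<Sum>i<m. (norm (w i))\<^sup>2)"
proof -
  have "(norm (\<Sum>i<m. w i))\<^sup>2 \<le> (\<Sum>i<m. norm (w i))\<^sup>2"
    by (intro power_mono norm_sum) simp
  also have "\<dots> \<le> real m * (\<Sum>i<m. (norm (w i))\<^sup>2)"
    using sum_squared_le_sum_of_squares[of "\<lambda>i. norm (w i)" "{..<m}"] by (simp add: mult.commute)
  finally show ?thesis .
qed

text \<open>Inverting about \<open>z\<close> turns the form into \<open>w \<mapsto> Q z |w|\<^sup>2 - b \<bullet> cnj w + \<alpha>\<close>, which is concave when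
  \<open>Q z \<le> 0\<close>; this is Jensen's inequality for it, the \<open>n - m\<close> missing points lying at infinity (\<open>w = 0\<close>).\<close>

lemma circ_form_harmonic_mean:
  fixes r :: "nat \<Rightarrow> complex"
  assumes "n > 0" "m \<le> n" "m = n \<or> \<alpha> \<ge> 0"
    and "\<And>i. i < m \<Longrightarrow> r i \<noteq> z" "y \<noteq> z"
    and "circ_form \<alpha> \<beta> \<delta> z \<le> 0"
    and "(\<Sum>i<m. 1 / (z - r i)) = of_nat n / (z - y)"
  shows "(\<Sum>i<m. circ_form \<alpha> \<beta> \<delta> (r i) * (norm (1 / (z - r i)))\<^sup>2)
    \<le> real n * circ_form \<alpha> \<beta> \<delta> y * (norm (1 / (z - y)))\<^sup>2"
proof -
  define q where "q = circ_form \<alpha> \<beta> \<delta> z"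
  \<comment> \<open>The gradient of the form at \<open>z\<close>: the form at \<open>z - u\<close>
    is \<open>q - b . u + alpha |u|^2\<close>, and dividing by \<open>|u|^2\<close> gives
    \<open>inv\<close>.\<close>
  define b where "b = (2 * \<alpha>) *\<^sub>R z + \<beta>"
  define w where "w i = 1 / (z - r i)" for i
  define W where "W = 1 / (z - y)"
  have inv: "circ_form \<alpha> \<beta> \<delta> x * (norm (1 / (z - x)))\<^sup>2 =
      q * (norm (1 / (z - x)))\<^sup>2 - b \<bullet> cnj (1 / (z - x)) + \<alpha>" if "x \<noteq> z" for x
  proof -
    define u where "u = z - x"
    have u: "u \<noteq> 0" "x = z - u" using that by (auto simp: u_def)
    have c: "cnj (1 / u) = (1 / (norm u)\<^sup>2) *\<^sub>R u"
      using u(1) complex_norm_square[of u] by (simp add: scaleR_conv_of_real field_simps)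
    have "circ_form \<alpha> \<beta> \<delta> (z - u) = q - b \<bullet> u + \<alpha> * (norm u)\<^sup>2"
      by (simp add: q_def b_def circ_form_def power2_norm_eq_inner inner_simps inner_commute algebra_simps)
    then have "circ_form \<alpha> \<beta> \<delta> x * (norm (1 / u))\<^sup>2 = q * (norm (1 / u))\<^sup>2 - b \<bullet> cnj (1 / u) + \<alpha>"
      unfolding c u(2) using u(1) by (simp add: norm_divide field_simps)
    then show ?thesis by (simp add: u_def)
  qed
  have sw: "(\<Sum>i<m. w i) = of_nat n * W" using assms(7) by (simp add: w_def W_def)
  \<comment> \<open>Cauchy-Schwarz for \<open>m\<close> points, weakened to \<open>n\<close> points;
    multiplying by \<open>q\<close>, which is at most 0, then reverses the inequality.\<close>
  have "(real n)\<^sup>2 * (norm W)\<^sup>2 \<le> real m * (\<Sum>i<m. (norm (w i))\<^sup>2)"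
    using norm_sum_power2_le[of w m] by (simp add: sw norm_mult power_mult_distrib)
  also have "\<dots> \<le> real n * (\<Sum>i<m. (norm (w i))\<^sup>2)"
    using assms(2) by (intro mult_right_mono sum_nonneg) auto
  finally have "real n * (norm W)\<^sup>2 \<le> (\<Sum>i<m. (norm (w i))\<^sup>2)"
    using assms(1) by (simp add: power2_eq_square)
  then have 1: "q * (\<Sum>i<m. (norm (w i))\<^sup>2) \<le> q * (real n * (norm W)\<^sup>2)"
    using assms(6) by (intro mult_left_mono_neg) (auto simp: q_def)
  have 2: "(\<Sum>i<m. b \<bullet> cnj (w i)) = real n * (b \<bullet> cnj W)"
  proof -
    have "(\<Sum>i<m. b \<bullet> cnj (w i)) = b \<bullet> cnj (\<Sum>i<m. w i)" by (simp add: inner_sum_right)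
    also have "cnj (\<Sum>i<m. w i) = real n *\<^sub>R cnj W" unfolding sw by (simp add: scaleR_conv_of_real)
    finally show ?thesis by simp
  qed
  \<comment> \<open>Each of the \<open>n - m\<close> points at infinity would contribute alpha to
    the sum; either there are none or alpha is nonnegative.\<close>
  have 3: "real m * \<alpha> \<le> real n * \<alpha>" using assms(2,3) by (auto intro: mult_right_mono)
  have "(\<Sum>i<m. circ_form \<alpha> \<beta> \<delta> (r i) * (norm (w i))\<^sup>2) =
      (\<Sum>i<m. q * (norm (w i))\<^sup>2 - b \<bullet> cnj (w i) + \<alpha>)"
    using inv assms(4) by (intro sum.cong) (auto simp: w_def)
  also have "\<dots> = q * (\<Sum>i<m. (norm (w i))\<^sup>2) - real n * (b \<bullet> cnj W) + real m * \<alpha>"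
    by (simp add: sum.distrib sum_subtractf sum_distrib_left 2)
  also have "\<dots> \<le> real n * (q * (norm W)\<^sup>2 - b \<bullet> cnj W + \<alpha>)"
    using 1 3 by (simp add: algebra_simps)
  also have "\<dots> = real n * (circ_form \<alpha> \<beta> \<delta> y * (norm W)\<^sup>2)"
    using inv[OF assms(5)] by (simp add: W_def)
  finally show ?thesis by (simp add: w_def W_def)
qed

text \<open>The counterpart of \<open>circ_form_harmonic_mean\<close> with \<open>z\<close> at
  infinity: here the form itself is concave and needs no inversion.\<close>

lemma circ_form_mean:
  fixes r :: "nat \<Rightarrow> complex"
  assumes "\<alpha> \<le> 0" "n > 0" "(\<Sum>i<n. r i) = of_nat n * y"
  shows "(\<Sum>i<n. circ_form \<alpha> \<beta> \<delta> (r i)) \<le> real n * circ_form \<alpha> \<beta> \<delta> y"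
proof -
  have "(real n)\<^sup>2 * (norm y)\<^sup>2 \<le> real n * (\<Sum>i<n. (norm (r i))\<^sup>2)"
    using norm_sum_power2_le[of r n] by (simp add: assms(3) norm_mult power_mult_distrib)
  then have "real n * (norm y)\<^sup>2 \<le> (\<Sum>i<n. (norm (r i))\<^sup>2)"
    using assms(2) by (simp add: power2_eq_square)
  then have "\<alpha> * (\<Sum>i<n. (norm (r i))\<^sup>2) \<le> \<alpha> * (real n * (norm y)\<^sup>2)"
    using assms(1) by (intro mult_left_mono_neg) auto
  moreover have "(\<Sum>i<n. \<beta> \<bullet> r i) = real n * (\<beta> \<bullet> y)"
  proof -
    have "(\<Sum>i<n. \<beta> \<bullet> r i) = \<beta> \<bullet> (real n *\<^sub>R y)"
      by (simp add: inner_sum_right[symmetric] assms(3) scaleR_conv_of_real)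
    then show ?thesis by simp
  qed
  ultimately show ?thesis
    by (simp add: circ_form_def sum.distrib sum_distrib_left[symmetric] algebra_simps)
qed

text \<open>If the polar derivative vanished at \<open>z\<close>, then \<open>n / (z - y)\<close>
  would be the sum of \<open>1 / (z - r i)\<close> over the roots. By
  \<open>circ_form_harmonic_mean\<close>, \<open>y\<close> and \<open>z\<close> could not both lie
  in \<open>K\<close> with every root outside. Roots missing from degree \<open>n\<close> sit at
  infinity, which is harmless when alpha is nonnegative.\<close>

lemma laguerre:
  fixes f :: "complex poly"
  assumes K: "K = {z. circ_form \<alpha> \<beta> \<delta> z < 0} \<or> K = {z. circ_form \<alpha> \<beta> \<delta> z \<le> 0}"
    and n: "n > 0" "degree f \<le> n" and deg: "\<alpha> \<ge> 0 \<or> degree f = n"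
    and nz: "\<And>z. z \<in> K \<Longrightarrow> poly f z \<noteq> 0" and yz: "y \<in> K" "z \<in> K"
  shows "of_nat n * poly f z + (y - z) * poly (pderiv f) z \<noteq> 0"
proof
  assume eq: "of_nat n * poly f z + (y - z) * poly (pderiv f) z = 0"
  let ?Q = "circ_form \<alpha> \<beta> \<delta>"
  define m where "m = degree f"
  have "f \<noteq> 0" using nz[OF yz(1)] by auto
  then obtain r where r: "f = smult (lead_coeff f) (\<Prod>i<m. [:- r i, 1:])"
    using poly_roots_indexed unfolding m_def by blast
  have fz: "poly f z \<noteq> 0" using nz yz by auto
  have rK: "r i \<notin> K" if "i < m" for i
  proof -
    have "poly f (r i) = 0" using that by (subst r) (auto simp: poly_prod)
    then show ?thesis using nz by blast
  qed
  then have rz: "z \<noteq> r i" if "i < m" for i using yz that by auto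
  have zy: "y \<noteq> z" using eq fz n by auto
  have "poly (pderiv f) z = poly f z * (\<Sum>i<m. 1 / (z - r i))"
    using poly_pderiv_prod_linear[of m z r, OF rz]
    by (subst r, subst (2) r) (simp add: pderiv_smult)
  with eq have "poly f z * (of_nat n + (y - z) * (\<Sum>i<m. 1 / (z - r i))) = 0"
    by (simp add: algebra_simps)
  with fz have "of_nat n + (y - z) * (\<Sum>i<m. 1 / (z - r i)) = 0" by simp
  then have s: "(\<Sum>i<m. 1 / (z - r i)) = of_nat n / (z - y)"
    using zy by (simp add: field_simps)
  \<comment> \<open>At least one root is needed for a strict sum in the case of a closed region.
    Without roots, \<open>s\<close> would equate 0 with a nonzero quotient.\<close>
  have "m \<noteq> 0"
  proof
    assume "m = 0"
    then show False using s n zy by simp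
  qed
  have "?Q z \<le> 0" using K yz by auto
  then have le: "(\<Sum>i<m. ?Q (r i) * (norm (1 / (z - r i)))\<^sup>2) \<le> real n * ?Q y * (norm (1 / (z - y)))\<^sup>2"
    using n deg rz zy s by (intro circ_form_harmonic_mean) (auto simp: m_def)
  have W: "(norm (1 / (z - y)))\<^sup>2 > 0" "\<And>i. i < m \<Longrightarrow> (norm (1 / (z - r i)))\<^sup>2 > 0"
    using zy rz by auto
  \<comment> \<open>The strict sign comes from \<open>y\<close> when \<open>K\<close> is defined by
    a strict inequality, and from the roots otherwise; either way it contradicts
    \<open>le\<close>.\<close>
  from K show False
  proof
    assume K: "K = {z. ?Q z < 0}"
    have "(\<Sum>i<m. ?Q (r i) * (norm (1 / (z - r i)))\<^sup>2) \<ge> 0"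
      using rK K by (intro sum_nonneg mult_nonneg_nonneg) (auto simp: not_less)
    moreover have "real n * ?Q y * (norm (1 / (z - y)))\<^sup>2 < 0"
      using yz K n W(1) by (intro mult_neg_pos mult_pos_neg) auto
    ultimately show False using le by linarith
  next
    assume K: "K = {z. ?Q z \<le> 0}"
    have "(\<Sum>i<m. ?Q (r i) * (norm (1 / (z - r i)))\<^sup>2) > 0"
      using rK K W(2) \<open>m \<noteq> 0\<close> by (intro sum_pos mult_pos_pos) (auto simp: not_le)
    moreover have "real n * ?Q y * (norm (1 / (z - y)))\<^sup>2 \<le> 0"
      using yz K W(1) by (intro mult_nonpos_nonneg mult_nonneg_nonpos) auto
    ultimately show False using le by linarith
  qed
qed

text \<open>The expression is the coefficient of degree \<open>n\<close> of the polar derivative of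
  \<open>f\<close> at \<open>y\<close>, so its nonvanishing keeps the degree from dropping further.
  Were it zero, \<open>y\<close> would be the arithmetic mean of the roots, and
  \<open>circ_form_mean\<close> would give a contradiction.\<close>

lemma laguerre_at_infinity:
  fixes f :: "complex poly"
  assumes K: "K = {z. circ_form \<alpha> \<beta> \<delta> z < 0} \<or> K = {z. circ_form \<alpha> \<beta> \<delta> z \<le> 0}"
    and "\<alpha> \<le> 0" and deg: "degree f = Suc n"
    and nz: "\<And>z. z \<in> K \<Longrightarrow> poly f z \<noteq> 0" and y: "y \<in> K"
  shows "coeff f n + of_nat (Suc n) * y * coeff f (Suc n) \<noteq> 0"
proof
  assume eq: "coeff f n + of_nat (Suc n) * y * coeff f (Suc n) = 0"
  let ?Q = "circ_form \<alpha> \<beta> \<delta>"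
  have "f \<noteq> 0" using deg by auto
  then obtain r where r: "f = smult (lead_coeff f) (\<Prod>i<Suc n. [:- r i, 1:])"
    using poly_roots_indexed deg by metis
  have rK: "r i \<notin> K" if "i < Suc n" for i
  proof -
    have "poly f (r i) = 0" using that
      by (subst r) (auto simp: poly_prod simp del: prod.lessThan_Suc)
    then show ?thesis using nz by blast
  qed
  have "coeff f n = coeff (smult (lead_coeff f) (\<Prod>i<Suc n. [:- r i, 1:])) n"
    using r by metis
  also have "\<dots> = - coeff f (Suc n) * (\<Sum>i<Suc n. r i)"
    unfolding coeff_smult coeff_prod_linear_subtop deg by (simp only: mult_minus_right mult_minus_left)
  finally have "coeff f (Suc n) * ((\<Sum>i<Suc n. r i) - of_nat (Suc n) * y) = 0"
    using eq by (simp only: right_diff_distrib) (simp only: algebra_simps, algebra)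
  moreover have "coeff f (Suc n) \<noteq> 0" using \<open>f \<noteq> 0\<close> deg by (metis leading_coeff_0_iff)
  ultimately have "(\<Sum>i<Suc n. r i) = of_nat (Suc n) * y" by simp
  then have le: "(\<Sum>i<Suc n. ?Q (r i)) \<le> real (Suc n) * ?Q y"
    using assms(2) by (intro circ_form_mean) auto
  from K show False
  proof
    assume K: "K = {z. ?Q z < 0}"
    have "(\<Sum>i<Suc n. ?Q (r i)) \<ge> 0"
      using rK K by (intro sum_nonneg) (auto simp: not_less)
    moreover have "real (Suc n) * ?Q y < 0"
      using y K by (intro mult_pos_neg) auto
    ultimately show False using le by linarith
  next
    assume K: "K = {z. ?Q z \<le> 0}"
    have "(\<Sum>i<Suc n. ?Q (r i)) > 0"
      using rK K by (intro sum_pos) (auto simp: not_le)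
    moreover have "real (Suc n) * ?Q y \<le> 0"
      using y K by (intro mult_nonneg_nonpos) auto
    ultimately show False using le by linarith
  qed
qed

section \<open>Polarisation and the Grace-Walsh-Szego theorem\<close>

definition binom_poly :: "nat \<Rightarrow> (nat \<Rightarrow> complex) \<Rightarrow> complex poly" where
  "binom_poly n c = (\<Sum>k\<le>n. monom (c k * of_nat (n choose k)) k)"

text \<open>If \<open>ys\<close> has length \<open>n\<close>, this is \<open>\<Sum>k\<le>n. c k * e\<^sub>k(ys)\<close> with \<open>e\<^sub>k\<close> the elementary symmetric
  polynomials, i.e. the symmetric multiaffine form whose diagonal is \<open>binom_poly n c\<close>.\<close>

fun polar_form :: "(nat \<Rightarrow> complex) \<Rightarrow> complex list \<Rightarrow> complex" where
  "polar_form c [] = c 0"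
| "polar_form c (y # ys) = polar_form (\<lambda>k. c k + y * c (Suc k)) ys"

lemma coeff_binom_poly: "coeff (binom_poly n c) k = c k * of_nat (n choose k)"
  by (auto simp: binom_poly_def coeff_sum coeff_monom binomial_eq_0)

lemma degree_binom_poly: "degree (binom_poly n c) \<le> n"
  by (rule degree_le) (auto simp: coeff_binom_poly binomial_eq_0)

text \<open>Fixing one variable of the multiaffine form at \<open>y\<close> amounts, on the diagonal
  and up to the factor \<open>n + 1\<close>, to taking the polar derivative at \<open>y\<close>.
  This links the recursion of \<open>polar_form\<close> to \<open>laguerre\<close>.\<close>

lemma binom_poly_polar:
  "smult (of_nat (Suc n)) (binom_poly n (\<lambda>k. c k + y * c (Suc k))) =
    smult (of_nat (Suc n)) (binom_poly (Suc n) c) + [:y, -1:] * pderiv (binom_poly (Suc n) c)"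
  (is "?l = ?r")
proof (rule poly_eqI)
  fix k
  have a: "of_nat (Suc n) * (of_nat (n choose k) :: complex) = of_nat (Suc k) * of_nat (Suc n choose Suc k)"
    using Suc_times_binomial_eq[of n k] by (metis of_nat_mult mult.commute)
  \<comment> \<open>This is \<open>(n + 1) C(n,k) = (n + 1 - k) C(n+1,k)\<close>, written as a
    difference of complex numbers to avoid truncated subtraction.\<close>
  have b: "of_nat (Suc n) * (of_nat (n choose k) :: complex) =
      of_nat (Suc n) * of_nat (Suc n choose k) - of_nat k * of_nat (Suc n choose k)"
  proof (cases k)
    case (Suc j)
    have "of_nat (Suc n) * (of_nat (n choose j) :: complex) = of_nat (Suc j) * of_nat (Suc n choose Suc j)"
      using Suc_times_binomial_eq[of n j] by (metis of_nat_mult mult.commute)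
    moreover have "(of_nat (Suc n choose k) :: complex) = of_nat (n choose k) + of_nat (n choose j)"
      using Suc by simp
    ultimately show ?thesis using Suc by (simp add: algebra_simps)
  qed simp
  have r: "coeff ?r k = of_nat (Suc n) * coeff (binom_poly (Suc n) c) k
      + y * (of_nat (Suc k) * coeff (binom_poly (Suc n) c) (Suc k))
      - of_nat k * coeff (binom_poly (Suc n) c) k"
    by (cases k) (simp_all add: coeff_pderiv)
  have "coeff ?l k = c k * (of_nat (Suc n) * of_nat (n choose k))
      + y * c (Suc k) * (of_nat (Suc n) * of_nat (n choose k))"
    by (simp add: coeff_binom_poly algebra_simps)
  also have "\<dots> = c k * (of_nat (Suc n) * of_nat (Suc n choose k) - of_nat k * of_nat (Suc n choose k))
      + y * c (Suc k) * (of_nat (Suc k) * of_nat (Suc n choose Suc k))"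
    by (subst b, subst a) (rule refl)
  also have "\<dots> = coeff ?r k"
    unfolding r coeff_binom_poly by (simp only: algebra_simps)
  finally show "coeff ?l k = coeff ?r k" .
qed

text \<open>Variables are fixed one at a time. By \<open>laguerre\<close> the diagonal of the
  remaining form still has no zero in \<open>K\<close>; for negative alpha,
  \<open>laguerre_at_infinity\<close> also keeps its leading coefficient nonzero, so the induction
  can continue.\<close>

theorem grace_walsh_szego:
  assumes K: "K = {z. circ_form \<alpha> \<beta> \<delta> z < 0} \<or> K = {z. circ_form \<alpha> \<beta> \<delta> z \<le> 0}"
    and "K \<noteq> {}"
    and "\<alpha> \<ge> 0 \<or> c n \<noteq> 0"
    and "\<And>z. z \<in> K \<Longrightarrow> poly (binom_poly n c) z \<noteq> 0"
    and "length ys = n" "set ys \<subseteq> K"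
  shows "polar_form c ys \<noteq> 0"
  using assms(3-)
proof (induction ys arbitrary: n c)
  case Nil
  then have "poly (binom_poly 0 c) z \<noteq> 0" if "z \<in> K" for z using that by auto
  then show ?case using assms(2) by (auto simp: binom_poly_def)
next
  case (Cons y ys)
  then obtain m where m: "n = Suc m" "length ys = m" by auto
  have y: "y \<in> K" using Cons.prems by auto
  let ?c = "\<lambda>k. c k + y * c (Suc k)"
  let ?f = "binom_poly (Suc m) c"
  have deg: "degree ?f = Suc m" if "c (Suc m) \<noteq> 0"
    by (intro antisym degree_binom_poly le_degree) (use that in \<open>auto simp: coeff_binom_poly\<close>)
  have nz: "\<And>z. z \<in> K \<Longrightarrow> poly ?f z \<noteq> 0" using Cons.prems(2) m by auto
  have "polar_form ?c ys \<noteq> 0"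
  proof (rule Cons.IH[of ?c m])
    show "\<alpha> \<ge> 0 \<or> ?c m \<noteq> 0"
    proof (cases "\<alpha> \<ge> 0")
      case False
      then have "coeff ?f m + of_nat (Suc m) * y * coeff ?f (Suc m) \<noteq> 0"
        using K nz y deg Cons.prems(1) m by (intro laguerre_at_infinity) auto
      then have "of_nat (Suc m) * ?c m \<noteq> 0"
        by (simp add: coeff_binom_poly algebra_simps)
      then show ?thesis by auto
    qed simp
    show "poly (binom_poly m ?c) z \<noteq> 0" if "z \<in> K" for z
    proof -
      have "of_nat (Suc m) * poly ?f z + (y - z) * poly (pderiv ?f) z \<noteq> 0"
        using degree_binom_poly[of "Suc m" c] deg Cons.prems(1) m nz y that
        by (intro laguerre[OF K]) auto
      also have "of_nat (Suc m) * poly ?f z + (y - z) * poly (pderiv ?f) z =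
          poly (smult (of_nat (Suc m)) (binom_poly m ?c)) z"
        unfolding binom_poly_polar by (simp add: algebra_simps)
      finally show ?thesis by auto
    qed
  qed (use m Cons.prems in auto)
  then show ?case by simp
qed

section \<open>Diagonalisation of the Toeplitz form\<close>

text \<open>Multiplying \<open>p\<close> by \<open>1 + x X\<close> turns the Toeplitz form with symbol \<open>m\<close> into the one with symbol
  \<open>x ((x + 1/x) m + nbr_sum m)\<close>; iterating this diagonalises the quadratic form defining \<^const>\<open>T_op\<close>.\<close>

definition toeplitz_form :: "(int \<Rightarrow> complex) \<Rightarrow> nat \<Rightarrow> complex poly \<Rightarrow> complex" where
  "toeplitz_form m n p = (\<Sum>i\<le>n. \<Sum>j\<le>n. m (int j - int i) * coeff p i * coeff p j)"

definition nbr_sum :: "(int \<Rightarrow> complex) \<Rightarrow> int \<Rightarrow> complex" where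
  "nbr_sum m d = m (d - 1) + m (d + 1)"

lemma toeplitz_form_linear_factor:
  assumes "degree p \<le> n"
  shows "toeplitz_form m (Suc n) ([:1, x:] * p) =
    toeplitz_form (\<lambda>d. (1 + x\<^sup>2) * m d + x * nbr_sum m d) n p"
proof -
  have z: "coeff p (Suc n) = 0" using assms by (intro coeff_eq_0) auto
  have c: "coeff ([:1, x:] * p) i = coeff p i + (case i of 0 \<Rightarrow> 0 | Suc k \<Rightarrow> x * coeff p k)" for i
    by (cases i) simp_all
  \<comment> \<open>Multiplication by \<open>1 + x X\<close> is moved from the coefficients to the
    weights. Doing this once for each index yields the new symbol.\<close>
  have shift: "(\<Sum>i\<le>Suc n. g i * coeff ([:1, x:] * p) i) =
      (\<Sum>i\<le>n. (g i + x * g (Suc i)) * coeff p i)" for g :: "nat \<Rightarrow> complex"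
  proof -
    have "(\<Sum>i\<le>Suc n. g i * coeff ([:1, x:] * p) i) = (\<Sum>i\<le>Suc n. g i * coeff p i)
        + (\<Sum>i\<le>Suc n. g i * (case i of 0 \<Rightarrow> 0 | Suc k \<Rightarrow> x * coeff p k))"
      unfolding c by (simp only: distrib_left sum.distrib)
    also have "(\<Sum>i\<le>Suc n. g i * coeff p i) = (\<Sum>i\<le>n. g i * coeff p i)" by (simp add: z)
    also have "(\<Sum>i\<le>Suc n. g i * (case i of 0 \<Rightarrow> 0 | Suc k \<Rightarrow> x * coeff p k)) =
        (\<Sum>i\<le>n. x * g (Suc i) * coeff p i)"
      by (subst sum.atMost_Suc_shift) (simp add: mult_ac)
    finally show ?thesis by (simp add: sum.distrib algebra_simps)
  qed
  let ?q = "[:1, x:] * p"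
  have "toeplitz_form m (Suc n) ?q =
      (\<Sum>i\<le>Suc n. (\<Sum>j\<le>Suc n. m (int j - int i) * coeff ?q j) * coeff ?q i)"
    unfolding toeplitz_form_def sum_distrib_right by (simp only: mult_ac)
  also have "\<dots> = (\<Sum>i\<le>Suc n. (\<Sum>j\<le>n. (m (int j - int i) + x * m (int (Suc j) - int i)) * coeff p j) * coeff ?q i)"
    unfolding shift ..
  also have "\<dots> = (\<Sum>i\<le>n. ((\<Sum>j\<le>n. (m (int j - int i) + x * m (int (Suc j) - int i)) * coeff p j)
      + x * (\<Sum>j\<le>n. (m (int j - int (Suc i)) + x * m (int (Suc j) - int (Suc i))) * coeff p j)) * coeff p i)"
    unfolding shift ..
  also have "\<dots> = toeplitz_form (\<lambda>d. (1 + x\<^sup>2) * m d + x * nbr_sum m d) n p"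
    unfolding toeplitz_form_def sum_distrib_left sum_distrib_right sum.distrib[symmetric]
    by (intro sum.cong refl) (simp add: nbr_sum_def algebra_simps power2_eq_square)
  finally show ?thesis .
qed

lemma polar_form_cong:
  assumes "\<And>k. k \<le> length ys \<Longrightarrow> c k = c' k"
  shows "polar_form c ys = polar_form c' ys"
  using assms
proof (induction ys arbitrary: c c')
  case (Cons y ys)
  then have "polar_form (\<lambda>k. c k + y * c (Suc k)) ys = polar_form (\<lambda>k. c' k + y * c' (Suc k)) ys"
    by (intro Cons.IH) simp
  then show ?case by simp
qed simp

lemma polar_form_scale: "polar_form (\<lambda>k. a * c k) ys = a * polar_form c ys"
proof (induction ys arbitrary: c)
  case (Cons y ys)
  have "polar_form (\<lambda>k. a * c k + y * (a * c (Suc k))) ys =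
      polar_form (\<lambda>k. a * (c k + y * c (Suc k))) ys" by (simp add: algebra_simps)
  then show ?case using Cons[of "\<lambda>k. c k + y * c (Suc k)"] by simp
qed simp

lemma nbr_sum_funpow_linear:
  "(nbr_sum ^^ k) (\<lambda>d. a * m d + b * m' d) = (\<lambda>d. a * (nbr_sum ^^ k) m d + b * (nbr_sum ^^ k) m' d)"
  by (induction k) (simp_all add: nbr_sum_def fun_eq_iff algebra_simps)

lemma degree_prod_list_linear: "degree (\<Prod>x\<leftarrow>xs. [:1, x :: complex:]) \<le> length xs"
proof (induction xs)
  case (Cons x xs)
  have "degree ([:1, x:] * (\<Prod>x\<leftarrow>xs. [:1, x:])) \<le> degree [:1, x:] + degree (\<Prod>x\<leftarrow>xs. [:1, x:])"
    by (rule degree_mult_le)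
  also have "\<dots> \<le> 1 + length xs" using Cons by (intro add_mono) auto
  finally show ?case by simp
qed simp

text \<open>Peeling off a factor replaces the symbol by \<open>x\<close> times the sum of its
  multiple by \<open>x + 1/x\<close> and its \<open>nbr_sum\<close>. After all factors, a term with
  \<open>k\<close> values \<open>x + 1/x\<close> carries \<open>nbr_sum\<close> iterated
  \<open>length xs - k\<close> times.\<close>

lemma toeplitz_form_eq_polar_form:
  assumes "0 \<notin> set xs"
  shows "toeplitz_form m (length xs) (\<Prod>x\<leftarrow>xs. [:1, x:]) =
    prod_list xs * polar_form (\<lambda>k. (nbr_sum ^^ (length xs - k)) m 0) (map (\<lambda>x. x + 1 / x) xs)"
  using assms
proof (induction xs arbitrary: m)
  case Nil
  then show ?case by (simp add: toeplitz_form_def)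
next
  case (Cons x xs)
  have x: "x \<noteq> 0" using Cons.prems by auto
  let ?n = "length xs" and ?ys = "map (\<lambda>x. x + 1 / x) xs"
  let ?m = "\<lambda>d. (1 + x\<^sup>2) * m d + x * nbr_sum m d"
  have "toeplitz_form m (length (x # xs)) (\<Prod>x\<leftarrow>x # xs. [:1, x:]) =
      toeplitz_form ?m ?n (\<Prod>x\<leftarrow>xs. [:1, x:])"
    using toeplitz_form_linear_factor[OF degree_prod_list_linear[of xs]] by simp
  also have "\<dots> = prod_list xs * polar_form (\<lambda>k. (nbr_sum ^^ (?n - k)) ?m 0) ?ys"
    using Cons by simp
  also have "polar_form (\<lambda>k. (nbr_sum ^^ (?n - k)) ?m 0) ?ys = polar_form (\<lambda>k. x *
      ((nbr_sum ^^ (Suc ?n - k)) m 0 + (x + 1 / x) * (nbr_sum ^^ (Suc ?n - Suc k)) m 0)) ?ys"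
  proof (rule polar_form_cong)
    fix k assume "k \<le> length ?ys"
    \<comment> \<open>Subtraction is truncated, so this needs \<open>k\<close> to be at most
      \<open>length xs\<close>; hence the bound in \<open>polar_form_cong\<close>.\<close>
    then have s: "Suc ?n - k = Suc (?n - k)" by simp
    show "(nbr_sum ^^ (?n - k)) ?m 0 =
        x * ((nbr_sum ^^ (Suc ?n - k)) m 0 + (x + 1 / x) * (nbr_sum ^^ (Suc ?n - Suc k)) m 0)"
      unfolding nbr_sum_funpow_linear s funpow_Suc_right
      using x by (simp add: field_simps power2_eq_square)
  qed
  finally show ?case by (simp add: polar_form_scale)
qed

section \<open>Identification of \<open>gamma_seq\<close>, \<open>T_op\<close> and
  \<open>P_mu\<close>\<close>

text \<open>On formal series with coefficients \<open>m d\<close>, \<open>nbr_sum\<close> is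
  multiplication by \<open>t + 1/t\<close>; this is the binomial expansion of its
  \<open>k\<close>-th power.\<close>

lemma nbr_sum_funpow: "(nbr_sum ^^ k) m d = (\<Sum>j\<le>k. of_nat (k choose j) * m (d + int k - 2 * int j))"
proof (induction k arbitrary: d)
  case (Suc k)
  have "(nbr_sum ^^ Suc k) m d = (nbr_sum ^^ k) m (d + 1) + (nbr_sum ^^ k) m (d - 1)"
    by (simp add: nbr_sum_def)
  also have "(nbr_sum ^^ k) m (d + 1) =
      (\<Sum>j\<le>Suc k. of_nat (k choose j) * m (d + int (Suc k) - 2 * int j))"
    by (simp add: Suc.IH binomial_eq_0 algebra_simps)
  also have "(nbr_sum ^^ k) m (d - 1) =
      (\<Sum>j\<le>k. of_nat (k choose j) * m (d + int (Suc k) - 2 * int (Suc j)))"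
    by (simp add: Suc.IH algebra_simps)
  finally show ?case
    by (simp add: sum.atMost_Suc_shift sum.distrib algebra_simps del: sum.atMost_Suc)
qed simp

text \<open>Extension by zero turns the sum over \<open>i <= j\<close> in \<open>T_op\<close> into a
  full Toeplitz form, and cuts the binomial sum off at \<open>k div 2\<close> as in
  \<open>gamma_seq\<close>.\<close>

definition one_sided :: "(nat \<Rightarrow> complex) \<Rightarrow> int \<Rightarrow> complex" where
  "one_sided \<mu> d = (if d < 0 then 0 else \<mu> (nat d))"

lemma gamma_seq_eq_nbr_sum: "gamma_seq \<mu> k = (nbr_sum ^^ k) (one_sided \<mu>) 0"
proof -
  have "(nbr_sum ^^ k) (one_sided \<mu>) 0 =
      (\<Sum>j\<le>k div 2. of_nat (k choose j) * one_sided \<mu> (int k - 2 * int j))"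
    unfolding nbr_sum_funpow by (intro sum.mono_neutral_cong_right) (auto simp: one_sided_def)
  also have "\<dots> = gamma_seq \<mu> k"
    unfolding gamma_seq_def
    by (intro sum.cong refl) (auto simp: one_sided_def nat_diff_distrib nat_mult_distrib)
  finally show ?thesis by simp
qed

text \<open>Rescaling the variable by zeta absorbs the power \<open>zeta^(i+j)\<close> into the
  coefficients.\<close>

lemma poly_T_op:
  "poly (T_op \<mu> P) \<zeta> = toeplitz_form (one_sided \<mu>) (degree P) (pcompose P [:0, \<zeta>:])"
proof -
  have "poly (T_op \<mu> P) \<zeta> =
      (\<Sum>j\<le>degree P. \<Sum>i\<le>j. \<mu> (j - i) * coeff P i * coeff P j * \<zeta> ^ (i + j))"
    by (simp add: T_op_def poly_sum poly_monom)
  also have "\<dots> = (\<Sum>j\<le>degree P. \<Sum>i\<le>degree P.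
      one_sided \<mu> (int j - int i) * coeff P i * coeff P j * \<zeta> ^ (i + j))"
    by (intro sum.cong refl sum.mono_neutral_cong_left) (auto simp: one_sided_def nat_diff_distrib)
  also have "\<dots> = toeplitz_form (one_sided \<mu>) (degree P) (pcompose P [:0, \<zeta>:])"
    unfolding toeplitz_form_def coeff_pcompose_linear
    by (subst sum.swap) (simp add: power_add mult_ac)
  finally show ?thesis .
qed

lemma P_mu_eq_binom_poly: "P_mu \<mu> n = binom_poly n (\<lambda>k. gamma_seq \<mu> (n - k))"
  unfolding P_mu_def binom_poly_def
  by (rule sum.reindex_bij_witness[of _ "\<lambda>k. n - k" "\<lambda>k. n - k"])
     (auto simp: binomial_symmetric[symmetric])

theorem theorem7p1:
  fixes \<mu> :: "nat \<Rightarrow> complex" and n :: nat and P :: "complex poly"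
    and \<rho> :: "nat \<Rightarrow> complex" and K :: "complex set" and \<zeta> :: complex
  assumes "n > 0"
    and "degree P = n"
    and "coeff P 0 = 1"
    and "P = (\<Prod>j = 1..n. [:1, \<rho> j:])"
    and "circular_region K"
    and "\<forall>z\<in>K. poly (P_mu \<mu> n) z \<noteq> 0"
    and "\<mu> 0 = 0 \<and> gamma_seq \<mu> 0 = 0 \<longrightarrow> convex K"
    and "\<zeta> \<noteq> 0"
    and "{\<rho> i * \<zeta> + 1 / (\<rho> i * \<zeta>) | i. 1 \<le> i \<and> i \<le> n} \<subseteq> K"
  shows "poly (T_op \<mu> P) \<zeta> \<noteq> 0"
proof -
  define xs where "xs = map (\<lambda>i. \<rho> i * \<zeta>) [1..<Suc n]"
  \<comment> \<open>A vanishing root parameter would make a factor constant and push the degree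
    below \<open>n\<close>. Hence no reciprocal below takes the default value
    \<open>1 / 0 = 0\<close>.\<close>
  have \<rho>: "\<rho> i \<noteq> 0" if "1 \<le> i" "i \<le> n" for i
  proof
    assume "\<rho> i = 0"
    have "(\<Sum>j = 1..n. degree [:1, \<rho> j:]) < (\<Sum>j = 1..n. 1)"
      by (rule sum_strict_mono_ex1) (use that \<open>\<rho> i = 0\<close> in auto)
    moreover have "degree P \<le> (\<Sum>j = 1..n. degree [:1, \<rho> j:])"
      unfolding assms(4) using degree_prod_sum_le[of "{1..n}" "\<lambda>j. [:1, \<rho> j:]"] by (simp add: o_def)
    ultimately show False using assms(2) by simp
  qed
  have len: "length xs = n" by (simp add: xs_def)
  have nz: "0 \<notin> set xs" using \<rho> assms(8) by (auto simp: xs_def)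
  have "pcompose P [:0, \<zeta>:] = (\<Prod>j = 1..n. [:1, \<rho> j * \<zeta>:])"
    by (simp add: assms(4) pcompose_prod pcompose_pCons mult.commute)
  also have "\<dots> = (\<Prod>x\<leftarrow>xs. [:1, x:])"
    using prod.distinct_set_conv_list[of "[1..<Suc n]" "\<lambda>j. [:1, \<rho> j * \<zeta>:]"]
    by (simp add: xs_def o_def atLeastLessThanSuc_atLeastAtMost del: upt_Suc)
  finally have "poly (T_op \<mu> P) \<zeta> = prod_list xs *
      polar_form (\<lambda>k. gamma_seq \<mu> (n - k)) (map (\<lambda>x. x + 1 / x) xs)"
    using toeplitz_form_eq_polar_form[OF nz, of "one_sided \<mu>"]
    by (simp add: poly_T_op assms(2) len gamma_seq_eq_nbr_sum)
  moreover have "prod_list xs \<noteq> 0" using nz by (simp add: prod_list_zero_iff)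
  moreover have "polar_form (\<lambda>k. gamma_seq \<mu> (n - k)) (map (\<lambda>x. x + 1 / x) xs) \<noteq> 0"
  proof -
    obtain \<alpha> \<beta> \<delta> where K: "K = {z. circ_form \<alpha> \<beta> \<delta> z < 0} \<or> K = {z. circ_form \<alpha> \<beta> \<delta> z \<le> 0}"
      and conv: "convex K \<Longrightarrow> \<alpha> \<ge> 0"
      using circular_region_circ_form[OF assms(5)] by metis
    have sub: "set (map (\<lambda>x. x + 1 / x) xs) \<subseteq> K" using assms(9)
      by (intro subsetI, elim subsetD) (auto simp: xs_def simp del: upt_Suc)
    then have "K \<noteq> {}" using len assms(1) by (cases xs) auto
    \<comment> \<open>This is the coefficient of degree \<open>n\<close> in \<open>P_mu\<close>. If
      it is nonzero, alpha may have any sign; if it is zero, \<open>K\<close> is convex and alpha is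
      nonnegative.\<close>
    moreover have "gamma_seq \<mu> 0 = \<mu> 0" by (simp add: gamma_seq_def)
    ultimately show ?thesis
      using assms(6,7) conv sub len
      by (intro grace_walsh_szego[OF K]) (auto simp: P_mu_eq_binom_poly)
  qed
  ultimately show ?thesis by simp
qed

end
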